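(* Let $m_1,m_2,m_3$ be positive integers and let $k,r$ be integers with $k>r\ge0$. Then \[\begin{aligned} &(k-r)\sum_{n=1}^\infty\frac{H_n^{(m_1)}H_n^{(m_2)}H_n^{(m_3)}-H_n^{(m_1+m_2+m_3)}}{(n+r)(n+k)}\\ &=\sum_{j=1}^{k-r}\sum_{n=1}^\infty\left\{\frac{H_n^{(m_1)}H_n^{(m_2)}}{n^{m_3}(n+r+j-1)}+\frac{H_n^{(m_1)}H_n^{(m_3)}}{n^{m_2}(n+r+j-1)}+\frac{H_n^{(m_2)}H_n^{(m_3)}}{n^{m_1}(n+r+j-1)}\right\}\\ &\quad-\sum_{j=1}^{k-r}\sum_{n=1}^\infty\left\{\frac{H_n^{(m_1)}}{n^{m_2+m_3}(n+r+j-1)}+\frac{H_n^{(m_2)}}{n^{m_1+m_3}(n+r+j-1)}+\frac{H_n^{(m_3)}}{n^{m_1+m_2}(n+r+j-1)}\right\}. \end{aligned}\]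
   Context: For positive integers $n,p$: $H_n^{(p)}=\sum_{j=1}^n j^{-p}$. *)

theory Defs
  imports "HOL-Analysis.Analysis"
begin

definition gen_harm :: "nat \<Rightarrow> nat \<Rightarrow> real" where
  "gen_harm p n = (\<Sum>j=1..n. 1 / real j ^ p)"

end

theory Submission
  imports Defs
begin

text \<open>
  Write \<open>H m n\<close> for the generalized harmonic number of order \<open>m\<close>, and put
  \<open>A n = H m1 n * H m2 n * H m3 n - H (m1 + m2 + m3) n\<close>.  The kernel \<open>(k - r) / ((n + r) (n + k))\<close>
  telescopes into the differences \<open>1 / (n + r + j - 1) - 1 / (n + r + j)\<close>, \<open>1 \<le> j \<le> k - r\<close>.
  Summation by parts moves each difference onto \<open>A\<close>, and \<open>A n - A (n - 1)\<close> is exactly the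
  numerator on the right-hand side.  Convergence and the vanishing of the boundary term follow from
  \<open>H m n = O(n powr (1/4))\<close>.
\<close>

text \<open>Each term equals \<open>(A (Suc n) - A n) * b n\<close> minus the increment of
  \<open>A n * b n\<close>. Those increments telescope to the limit minus the initial value, and
  both are 0.\<close>

lemma summation_by_parts_sums:
  fixes A b :: "nat \<Rightarrow> real"
  assumes "A 0 = 0" and "(\<lambda>n. A n * b n) \<longlonglongrightarrow> 0"
    and "(\<lambda>n. (A (Suc n) - A n) * b n) sums L"
  shows "(\<lambda>n. A (Suc n) * (b n - b (Suc n))) sums L"
proof -
  have "(\<lambda>n. A (Suc n) * b (Suc n) - A n * b n) sums (0 - A 0 * b 0)"
    using assms(2) by (rule telescope_sums)
  from sums_diff[OF assms(3) this] show ?thesis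
    using assms(1) by (simp add: algebra_simps)
qed

lemma telescoping_kernel:
  fixes x :: real
  assumes "r \<le> k" and "x > 0"
  shows "(\<Sum>j=1..k - r. 1 / (x + real r + real j - 1) - 1 / (x + real r + real j))
    = (real k - real r) / ((x + real r) * (x + real k))"
proof -
  \<comment> \<open>A free length \<open>d\<close> makes induction possible and keeps the truncated
    subtraction \<open>k - r\<close> out of it.\<close>
  have "(\<Sum>j=1..d. 1 / (x + real r + real j - 1) - 1 / (x + real r + real j))
    = 1 / (x + real r) - 1 / (x + real r + real d)" for d
    by (induction d) (simp_all add: algebra_simps)
  from this[of "k - r"] show ?thesis
    using assms by (simp add: of_nat_diff divide_simps add_nonneg_eq_0_iff)
qed

lemma gen_harm_0 [simp]: "gen_harm p 0 = 0"
  by (simp add: gen_harm_def)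

lemma gen_harm_Suc: "gen_harm p (Suc n) = gen_harm p n + 1 / real (Suc n) ^ p"
  by (simp add: gen_harm_def)

lemma gen_harm_nonneg [simp]: "gen_harm p n \<ge> 0"
  by (simp add: gen_harm_def sum_nonneg)

lemma gen_harm_Suc_ge_1: "gen_harm p (Suc n) \<ge> 1"
proof (induction n)
  case 0
  show ?case by (simp add: gen_harm_Suc)
next
  case (Suc n)
  then show ?case
    using gen_harm_Suc[of p "Suc n"] by (smt (verit) divide_nonneg_nonneg of_nat_0_le_iff zero_le_power)
qed

text \<open>Logarithmic growth is traded for a power through \<open>ln y \<le> y - 1\<close> at
  \<open>y = n powr (1/4)\<close>. The exponent 1/4 is small enough for three factors to stay below
  order \<open>n\<close>, while two factors over \<open>n^2\<close> remain summable.\<close>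

lemma gen_harm_le_powr:
  assumes "p \<ge> 1"
  shows "gen_harm p n \<le> 4 * real n powr (1/4)"
proof (cases "n = 0")
  case False
  have "gen_harm p n \<le> harm n"
    unfolding gen_harm_def harm_def
  proof (rule sum_mono)
    fix j assume j: "j \<in> {1..n}"
    then have "real j ^ 1 \<le> real j ^ p"
      using assms by (intro power_increasing) auto
    then show "1 / real j ^ p \<le> inverse (of_nat j)"
      using j by (simp add: field_simps)
  qed
  \<comment> \<open>The sequence \<open>harm n - ln n\<close> decreases from its value 1 at
    \<open>n = 1\<close>.\<close>
  also have "\<dots> \<le> ln (real n) + 1"
    using False euler_mascheroni_sequence_decreasing[of 1 n] by (simp add: harm_expand)
  also have "ln (real n) = 4 * ln (real n powr (1/4))"
    using False by (simp add: ln_powr)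
  also have "ln (real n powr (1/4)) \<le> real n powr (1/4) - 1"
    using False by (intro ln_le_minus_one) simp
  finally show ?thesis by simp
qed simp

lemma gen_harm_mult_le_powr:
  assumes "p \<ge> 1" and "q \<ge> 1"
  shows "gen_harm p n * gen_harm q n \<le> 16 * real n powr (1/2)"
proof -
  have "gen_harm p n * gen_harm q n \<le> (4 * real n powr (1/4)) * (4 * real n powr (1/4))"
    using assms by (intro mult_mono gen_harm_le_powr) auto
  also have "\<dots> = 16 * real n powr (1/2)"
    by (simp add: powr_add[symmetric])
  finally show ?thesis .
qed

text \<open>The abstract \<open>d\<close> covers the shifted denominators
  \<open>n + r + j - 1\<close> for all \<open>j \<ge> 1\<close> at once.\<close>

lemma summable_gen_harm_mult:
  fixes d :: "nat \<Rightarrow> real"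
  assumes "p \<ge> 1" "q \<ge> 1" "m \<ge> 1" and d: "\<And>n. d n \<ge> real (Suc n)"
  shows "summable (\<lambda>n. gen_harm p (Suc n) * gen_harm q (Suc n) / (real (Suc n) ^ m * d n))"
proof (rule summable_comparison_test')
  have "summable (\<lambda>n. real n powr (-3/2))"
    by (simp add: summable_real_powr_iff)
  then have "summable (\<lambda>n. real (Suc n) powr (-3/2))"
    by (subst summable_Suc_iff)
  then show "summable (\<lambda>n. 16 * real (Suc n) powr (-3/2))"
    by (rule summable_mult)
next
  fix n :: nat
  let ?x = "real (Suc n)"
  have d0: "d n > 0"
    using d[of n] by linarith
  \<comment> \<open>The worst case is \<open>m = 1\<close> with \<open>d n = ?x\<close>, leaving the
    exponent 1/2 - 2 = -3/2.\<close>
  have "?x ^ 1 * ?x \<le> ?x ^ m * d n"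
    using assms(3) d[of n] by (intro mult_mono power_increasing) auto
  then have "gen_harm p (Suc n) * gen_harm q (Suc n) / (?x ^ m * d n) \<le> 16 * ?x powr (1/2) / (?x * ?x)"
    using assms(1,2) by (intro frac_le gen_harm_mult_le_powr) auto
  also have "\<dots> = 16 * (?x powr (1/2) / ?x powr 2)"
    by (simp add: power2_eq_square)
  also have "?x powr (1/2) / ?x powr 2 = ?x powr (-3/2)"
    by (simp only: powr_diff[symmetric]) simp
  finally show "norm (gen_harm p (Suc n) * gen_harm q (Suc n) / (?x ^ m * d n)) \<le> 16 * ?x powr (-3/2)"
    using d0 by simp
qed

text \<open>Inserting the factor \<open>gen_harm 1 (Suc n)\<close>, which is at least 1, reduces
  this to the case of two factors.\<close>

lemma summable_gen_harm:
  fixes d :: "nat \<Rightarrow> real"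
  assumes "p \<ge> 1" "m \<ge> 1" and d: "\<And>n. d n \<ge> real (Suc n)"
  shows "summable (\<lambda>n. gen_harm p (Suc n) / (real (Suc n) ^ m * d n))"
proof (rule summable_comparison_test')
  show "summable (\<lambda>n. gen_harm p (Suc n) * gen_harm 1 (Suc n) / (real (Suc n) ^ m * d n))"
    using assms by (intro summable_gen_harm_mult) auto
next
  fix n :: nat
  have d0: "d n > 0"
    using d[of n] by linarith
  have "gen_harm p (Suc n) * 1 \<le> gen_harm p (Suc n) * gen_harm 1 (Suc n)"
    by (intro mult_left_mono gen_harm_Suc_ge_1) simp
  then show "norm (gen_harm p (Suc n) / (real (Suc n) ^ m * d n))
      \<le> gen_harm p (Suc n) * gen_harm 1 (Suc n) / (real (Suc n) ^ m * d n)"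
    using d0 by (simp add: divide_right_mono)
qed

definition triple_diff :: "nat \<Rightarrow> nat \<Rightarrow> nat \<Rightarrow> nat \<Rightarrow> real" where
  "triple_diff a b c n = gen_harm a n * gen_harm b n * gen_harm c n - gen_harm (a + b + c) n"

text \<open>Expanding the product in the updated values and the three increments leaves over the
  product of all increments. The subtracted harmonic number of order \<open>a + b + c\<close> grows
  by exactly that product and cancels it.\<close>

lemma triple_diff_Suc_minus:
  "triple_diff a b c (Suc n) - triple_diff a b c n =
     (gen_harm a (Suc n) * gen_harm b (Suc n) / real (Suc n) ^ c +
      gen_harm a (Suc n) * gen_harm c (Suc n) / real (Suc n) ^ b +
      gen_harm b (Suc n) * gen_harm c (Suc n) / real (Suc n) ^ a) -
     (gen_harm a (Suc n) / real (Suc n) ^ (b + c) +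
      gen_harm b (Suc n) / real (Suc n) ^ (a + c) +
      gen_harm c (Suc n) / real (Suc n) ^ (a + b))"
proof -
  define u v w x y z where defs: "u = gen_harm a n" "v = gen_harm b n" "w = gen_harm c n"
    "x = 1 / real (Suc n) ^ a" "y = 1 / real (Suc n) ^ b" "z = 1 / real (Suc n) ^ c"
  have "triple_diff a b c (Suc n) - triple_diff a b c n = (u + x) * (v + y) * (w + z) - u * v * w - x * y * z"
    unfolding defs triple_diff_def gen_harm_Suc by (simp add: power_add)
  also have "\<dots> =
      ((u + x) * (v + y) * z + (u + x) * (w + z) * y + (v + y) * (w + z) * x) -
      ((u + x) * (y * z) + (v + y) * (x * z) + (w + z) * (x * y))"
    by algebra
  finally show ?thesis
    unfolding defs gen_harm_Suc by (simp add: power_add)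
qed

text \<open>The constant is 64 + 4, one summand for the triple product and one for the subtracted
  term. An exponent below 1 is what makes the boundary term vanish.\<close>

lemma abs_triple_diff_le:
  assumes "a \<ge> 1" "b \<ge> 1" "c \<ge> 1"
  shows "\<bar>triple_diff a b c n\<bar> \<le> 68 * real n powr (3/4)"
proof (cases "n = 0")
  case False
  have "gen_harm a n * gen_harm b n * gen_harm c n \<le> (16 * real n powr (1/2)) * (4 * real n powr (1/4))"
    using assms by (intro mult_mono gen_harm_mult_le_powr gen_harm_le_powr) auto
  also have "\<dots> = 64 * real n powr (3/4)"
    by (simp add: powr_add[symmetric])
  finally have 1: "gen_harm a n * gen_harm b n * gen_harm c n \<le> 64 * real n powr (3/4)" .
  have "gen_harm (a + b + c) n \<le> 4 * real n powr (1/4)"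
    using assms by (intro gen_harm_le_powr) auto
  also have "\<dots> \<le> 4 * real n powr (3/4)"
    using False by (intro mult_left_mono powr_mono) auto
  finally have 2: "gen_harm (a + b + c) n \<le> 4 * real n powr (3/4)" .
  have "0 \<le> gen_harm a n * gen_harm b n * gen_harm c n" "0 \<le> gen_harm (a + b + c) n"
    by simp_all
  with 1 2 show ?thesis
    unfolding triple_diff_def by linarith
qed (simp add: triple_diff_def)

lemma triple_diff_div_tendsto_0:
  fixes d :: "nat \<Rightarrow> real"
  assumes "a \<ge> 1" "b \<ge> 1" "c \<ge> 1" and d: "\<And>n. d n \<ge> real (Suc n)"
  shows "(\<lambda>n. triple_diff a b c n * (1 / d n)) \<longlonglongrightarrow> 0"
proof (rule Lim_null_comparison)
  have "(\<lambda>n. real n powr (-1/4)) \<longlonglongrightarrow> 0"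
    by (intro tendsto_neg_powr filterlim_real_sequentially) simp
  then show "(\<lambda>n. 68 * real n powr (-1/4)) \<longlonglongrightarrow> 0"
    by (rule tendsto_mult_right_zero)
  show "eventually (\<lambda>n. norm (triple_diff a b c n * (1 / d n)) \<le> 68 * real n powr (-1/4)) sequentially"
    using eventually_gt_at_top[of 0]
  proof eventually_elim
    case (elim n)
    have dn: "real n \<le> d n"
      using d[of n] by linarith
    have "norm (triple_diff a b c n * (1 / d n)) = \<bar>triple_diff a b c n\<bar> / d n"
      using dn elim by (simp add: abs_mult)
    also have "\<dots> \<le> 68 * real n powr (3/4) / real n"
      using assms(1-3) dn elim by (intro frac_le abs_triple_diff_le) auto
    also have "\<dots> = 68 * (real n powr (3/4) / real n powr 1)"
      using elim by simp
    also have "real n powr (3/4) / real n powr 1 = real n powr (-1/4)"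
      by (simp only: powr_diff[symmetric]) simp
    finally show ?case .
  qed
qed

(* Every series over n = 1, 2, ... is indexed by Suc n.  The first three conjuncts make
   convergence explicit, since suminf is unspecified for a divergent series. *)
theorem corollary3p14:
  fixes m1 m2 m3 k r :: nat
  assumes "m1 \<ge> 1" and "m2 \<ge> 1" and "m3 \<ge> 1" and "r < k"
  shows
    "summable (\<lambda>n.
           (gen_harm m1 (Suc n) * gen_harm m2 (Suc n) * gen_harm m3 (Suc n) - gen_harm (m1 + m2 + m3) (Suc n))
           / ((real (Suc n) + real r) * (real (Suc n) + real k))) \<and>
     (\<forall>j\<in>{1..k - r}. summable (\<lambda>n.
              gen_harm m1 (Suc n) * gen_harm m2 (Suc n) / (real (Suc n) ^ m3 * (real (Suc n) + real r + real j - 1)) +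
              gen_harm m1 (Suc n) * gen_harm m3 (Suc n) / (real (Suc n) ^ m2 * (real (Suc n) + real r + real j - 1)) +
              gen_harm m2 (Suc n) * gen_harm m3 (Suc n) / (real (Suc n) ^ m1 * (real (Suc n) + real r + real j - 1)))) \<and>
     (\<forall>j\<in>{1..k - r}. summable (\<lambda>n.
              gen_harm m1 (Suc n) / (real (Suc n) ^ (m2 + m3) * (real (Suc n) + real r + real j - 1)) +
              gen_harm m2 (Suc n) / (real (Suc n) ^ (m1 + m3) * (real (Suc n) + real r + real j - 1)) +
              gen_harm m3 (Suc n) / (real (Suc n) ^ (m1 + m2) * (real (Suc n) + real r + real j - 1)))) \<and>
     (real k - real r) * (\<Sum>n.
           (gen_harm m1 (Suc n) * gen_harm m2 (Suc n) * gen_harm m3 (Suc n) - gen_harm (m1 + m2 + m3) (Suc n))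
           / ((real (Suc n) + real r) * (real (Suc n) + real k))) =
       (\<Sum>j=1..k - r. \<Sum>n.
              gen_harm m1 (Suc n) * gen_harm m2 (Suc n) / (real (Suc n) ^ m3 * (real (Suc n) + real r + real j - 1)) +
              gen_harm m1 (Suc n) * gen_harm m3 (Suc n) / (real (Suc n) ^ m2 * (real (Suc n) + real r + real j - 1)) +
              gen_harm m2 (Suc n) * gen_harm m3 (Suc n) / (real (Suc n) ^ m1 * (real (Suc n) + real r + real j - 1))) -
       (\<Sum>j=1..k - r. \<Sum>n.
              gen_harm m1 (Suc n) / (real (Suc n) ^ (m2 + m3) * (real (Suc n) + real r + real j - 1)) +
              gen_harm m2 (Suc n) / (real (Suc n) ^ (m1 + m3) * (real (Suc n) + real r + real j - 1)) +
              gen_harm m3 (Suc n) / (real (Suc n) ^ (m1 + m2) * (real (Suc n) + real r + real j - 1)))"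
proof -
  let ?A = "triple_diff m1 m2 m3"
  define P where "P j n =
      gen_harm m1 (Suc n) * gen_harm m2 (Suc n) / (real (Suc n) ^ m3 * (real (Suc n) + real r + real j - 1)) +
      gen_harm m1 (Suc n) * gen_harm m3 (Suc n) / (real (Suc n) ^ m2 * (real (Suc n) + real r + real j - 1)) +
      gen_harm m2 (Suc n) * gen_harm m3 (Suc n) / (real (Suc n) ^ m1 * (real (Suc n) + real r + real j - 1))"
    for j n :: nat
  define Q where "Q j n =
      gen_harm m1 (Suc n) / (real (Suc n) ^ (m2 + m3) * (real (Suc n) + real r + real j - 1)) +
      gen_harm m2 (Suc n) / (real (Suc n) ^ (m1 + m3) * (real (Suc n) + real r + real j - 1)) +
      gen_harm m3 (Suc n) / (real (Suc n) ^ (m1 + m2) * (real (Suc n) + real r + real j - 1))"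
    for j n :: nat
  define T where "T n = ?A (Suc n) / ((real (Suc n) + real r) * (real (Suc n) + real k))" for n
  have P: "summable (P j)" and Q: "summable (Q j)" if "j \<ge> 1" for j
    unfolding P_def Q_def using assms that
    by (intro summable_add summable_gen_harm_mult summable_gen_harm; simp)+
  have by_parts: "(\<lambda>n. ?A (Suc n) * (1 / (real (Suc n) + real r + real j - 1) - 1 / (real (Suc n) + real r + real j)))
      sums (suminf (P j) - suminf (Q j))" if "j \<ge> 1" for j
  proof -
    \<comment> \<open>Although written with \<open>Suc n\<close>, \<open>b n\<close> is
      \<open>1 / (n + r + j)\<close>, so \<open>b n - b (Suc n)\<close> is the \<open>j\<close>-th
      kernel difference at index \<open>Suc n\<close>.\<close>
    define b where "b n = 1 / (real (Suc n) + real r + real j - 1)" for n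
    have PQ: "P j n - Q j n = (?A (Suc n) - ?A n) * b n" for n
      unfolding P_def Q_def triple_diff_Suc_minus b_def
      by (simp add: add_divide_distrib diff_divide_distrib del: of_nat_Suc)
    have "(\<lambda>n. P j n - Q j n) sums (suminf (P j) - suminf (Q j))"
      using P Q that by (intro sums_diff summable_sums)
    then have "(\<lambda>n. (?A (Suc n) - ?A n) * b n) sums (suminf (P j) - suminf (Q j))"
      unfolding PQ .
    moreover have "(\<lambda>n. ?A n * b n) \<longlonglongrightarrow> 0"
      \<comment> \<open>Here \<open>j \<ge> 1\<close> gives \<open>r + j - 1 \<ge> 0\<close>, so the
        denominator is at least \<open>Suc n\<close>.\<close>
      unfolding b_def using assms that by (intro triple_diff_div_tendsto_0) auto
    ultimately have "(\<lambda>n. ?A (Suc n) * (b n - b (Suc n))) sums (suminf (P j) - suminf (Q j))"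
      by (intro summation_by_parts_sums) (simp_all add: triple_diff_def)
    then show ?thesis
      by (simp add: b_def add_ac)
  qed
  \<comment> \<open>The sum over \<open>j\<close> is finite, so it may be moved inside the
    convergent series.\<close>
  have "(\<lambda>n. \<Sum>j=1..k - r. ?A (Suc n) * (1 / (real (Suc n) + real r + real j - 1) - 1 / (real (Suc n) + real r + real j)))
      sums (\<Sum>j=1..k - r. suminf (P j) - suminf (Q j))"
    by (intro sums_sum by_parts) simp
  moreover have "(\<Sum>j=1..k - r. ?A (Suc n) * (1 / (real (Suc n) + real r + real j - 1) - 1 / (real (Suc n) + real r + real j)))
      = (real k - real r) * T n" for n
    unfolding sum_distrib_left[symmetric] T_def
    using assms by (subst telescoping_kernel) auto
  ultimately have sums: "(\<lambda>n. (real k - real r) * T n) sums ((\<Sum>j=1..k - r. suminf (P j)) - (\<Sum>j=1..k - r. suminf (Q j)))"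
    by (simp add: sum_subtractf)
  \<comment> \<open>The factor \<open>real k - real r\<close> is nonzero, so summability passes from
    the scaled series to \<open>T\<close>.\<close>
  then have T: "summable T"
    using \<open>r < k\<close> by (auto dest: sums_summable)
  moreover have "(real k - real r) * suminf T = (\<Sum>j=1..k - r. suminf (P j)) - (\<Sum>j=1..k - r. suminf (Q j))"
    using sums_unique2[OF summable_sums[OF T, THEN sums_mult] sums] .
  ultimately show ?thesis
    using P Q unfolding P_def Q_def T_def triple_diff_def by auto
qed

end
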